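(* Let $M\in\mathbb{C}^{p\times p}$ be nonsingular, let $\mathcal{A}\in\mathbb{C}^{m\times m\times p}$ have tubal index $k$, and let $\mathcal{B}\in\mathbb{C}^{m\times 1\times p}$. If $\mathcal{B}\in\mathscr{R}_M(\mathcal{A}*_M\mathcal{A}^{\mathrm{cep}})$, then the general solution $\mathcal{X}\in\mathbb{C}^{m\times 1\times p}$ of $$\mathcal{A}^{k+1}*_M\mathcal{X}=\mathcal{A}^k*_M\mathcal{B}$$ is $\mathcal{X}=\mathcal{A}^{\mathrm{cep}}*_M\mathcal{B}+(\mathcal{I}-\mathcal{A}^{\mathrm D}*_M\mathcal{A})*_M\mathcal{Z}$, where $\mathcal{Z}\in\mathbb{C}^{m\times 1\times p}$ is arbitrary; that is, the set of solutions is exactly the set of tensors of this form.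
   Context: Transform: for $\mathcal{A}\in\mathbb{C}^{m\times n\times p}$, $\tilde{\mathcal{A}}=\mathcal{A}\times_3 M\in\mathbb{C}^{m\times n\times p}$ is given by $(\tilde{\mathcal{A}})_{ijk}=\sum_{s=1}^p(\mathcal{A})_{ijs}M_{ks}$, and $\tilde{\mathcal{A}}^{(i)}=\tilde{\mathcal{A}}(:,:,i)$ is its $i$th frontal slice. Since $M$ is nonsingular, $\mathcal{A}\mapsto\tilde{\mathcal{A}}$ is a bijection. $M$-product: for $\mathcal{A}\in\mathbb{C}^{m\times n\times p}$, $\mathcal{B}\in\mathbb{C}^{n\times l\times p}$, $\mathcal{A}*_M\mathcal{B}$ is the unique $\mathcal{C}\in\mathbb{C}^{m\times l\times p}$ with $\tilde{\mathcal{C}}^{(i)}=\tilde{\mathcal{A}}^{(i)}\tilde{\mathcal{B}}^{(i)}$, $i=1,\dots,p$. The identity tensor $\mathcal{I}$ has $\tilde{\mathcal{I}}^{(i)}=I_m$ for all $i$; powers are taken with respect to $*_M$, with $\mathcal{A}^0=\mathcal{I}$. The conjugate transpose $\mathcal{A}^*$ is the tensor whose transform has $i$th frontal slice $(\tilde{\mathcal{A}}^{(i)})^{*}$ (matrix conjugate transpose). Range: $\mathscr{R}_M(\mathcal{A})=\{\mathcal{A}*_M\mathcal{Z}:\mathcal{Z}\in\mathbb{C}^{n\times 1\times p}\}$ for $\mathcal{A}\in\mathbb{C}^{m\times n\times p}$. Tubal index of $\mathcal{A}\in\mathbb{C}^{m\times m\times p}$: $k=\max_{1\le i\le p}\mathrm{ind}(\tilde{\mathcal{A}}^{(i)})$,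 where $\mathrm{ind}(A)$ is the least integer $k\ge 0$ with $\mathrm{rank}(A^k)=\mathrm{rank}(A^{k+1})$. Drazin inverse: for $\mathcal{A}$ of tubal index $k$, $\mathcal{A}^{\mathrm D}$ is the unique $\mathcal{X}\in\mathbb{C}^{m\times m\times p}$ with $\mathcal{X}*_M\mathcal{A}*_M\mathcal{X}=\mathcal{X}$, $\mathcal{A}*_M\mathcal{X}=\mathcal{X}*_M\mathcal{A}$ and $\mathcal{X}*_M\mathcal{A}^{k+1}=\mathcal{A}^k$. Core-EP inverse: for $\mathcal{A}$ of tubal index $k$, $\mathcal{A}^{\mathrm{cep}}$ is the tensor $\mathcal{X}\in\mathbb{C}^{m\times m\times p}$ satisfying $\mathcal{X}*_M\mathcal{A}^{k+1}=\mathcal{A}^k$, $\mathcal{A}*_M\mathcal{X}^2=\mathcal{X}$ and $(\mathcal{A}*_M\mathcal{X})^*=\mathcal{A}*_M\mathcal{X}$. *)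

theory Defs
  imports "HOL-Analysis.Analysis"
begin

text \<open>
  A tensor in \<open>C\<^sup>m\<^sup>\<times>\<^sup>n\<^sup>\<times>\<^sup>p\<close> is an element of \<open>complex^'p^'n^'m\<close>, so that \<open>A $ i $ j $ k\<close> is its
  \<open>(i,j,k)\<close> entry. Tensors with \<open>n = 1\<close> use the one-element index type \<open>1\<close>.

  Pitfall: the library's \<open>*\<close>, \<open>1\<close> and \<open>^\<close> on \<open>vec\<close> are entrywise. They are not used here for
  matrices or tensors; powers are defined separately below. Addition and subtraction are entrywise
  as they should be.
\<close>

definition mtransform :: "complex^'p^'p \<Rightarrow> complex^'p^'n^'m \<Rightarrow> complex^'p^'n^'m" where
  "mtransform M A = (\<chi> i j k. \<Sum>s\<in>UNIV. A $ i $ j $ s * M $ k $ s)"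

definition frontal_slice :: "complex^'p^'n^'m \<Rightarrow> 'p \<Rightarrow> complex^'n^'m" where
  "frontal_slice A k = (\<chi> i j. A $ i $ j $ k)"

abbreviation tslice :: "complex^'p^'p \<Rightarrow> complex^'p^'n^'m \<Rightarrow> 'p \<Rightarrow> complex^'n^'m" where
  "tslice M A i \<equiv> frontal_slice (mtransform M A) i"

text \<open>
  The definite description below is well defined for nonsingular \<open>M\<close>, see \<open>tensor_of_slices_ex1\<close>.
\<close>

definition tensor_of_slices :: "complex^'p^'p \<Rightarrow> ('p \<Rightarrow> complex^'n^'m) \<Rightarrow> complex^'p^'n^'m" where
  "tensor_of_slices M F = (THE C. \<forall>i. tslice M C i = F i)"

lemma mtransform_tube: "mtransform M A $ i $ j = M *v (A $ i $ j)"
  by (simp add: mtransform_def matrix_vector_mult_def mult.commute)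

lemma tensor_of_slices_ex1:
  fixes M :: "complex^'p^'p" and F :: "'p \<Rightarrow> complex^'n^'m"
  assumes "invertible M"
  shows "\<exists>!C. \<forall>i. tslice M C i = F i"
proof -
  obtain N where N: "M ** N = mat 1" "N ** M = mat 1"
    using assms by (auto simp: invertible_def)
  have tube: "tslice M C i $ a $ b = (M *v (C $ a $ b)) $ i" for C :: "complex^'p^'n^'m" and i a b
    by (simp add: frontal_slice_def mtransform_tube)
  have inj: "x = y" if "M *v x = M *v y" for x y :: "complex^'p"
  proof -
    have "N *v (M *v x) = N *v (M *v y)" using that by simp
    then show ?thesis by (simp add: matrix_vector_mul_assoc N)
  qed
  show ?thesis
  proof (rule ex1I)
    show "\<forall>i. tslice M (\<chi> a b. N *v (\<chi> i. F i $ a $ b)) i = F i"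
      by (simp add: vec_eq_iff tube matrix_vector_mul_assoc N)
  next
    fix C :: "complex^'p^'n^'m"
    assume C: "\<forall>i. tslice M C i = F i"
    have "C $ a $ b = N *v (\<chi> i. F i $ a $ b)" for a b
    proof (rule inj)
      have "(M *v (C $ a $ b)) $ i = F i $ a $ b" for i
        using C by (simp flip: tube)
      then show "M *v (C $ a $ b) = M *v (N *v (\<chi> i. F i $ a $ b))"
        by (simp add: matrix_vector_mul_assoc N vec_eq_iff)
    qed
    then show "C = (\<chi> a b. N *v (\<chi> i. F i $ a $ b))"
      by (simp add: vec_eq_iff)
  qed
qed

lemma tslice_tensor_of_slices:
  assumes "invertible M"
  shows "tslice M (tensor_of_slices M F) i = F i"
  unfolding tensor_of_slices_def
  by (rule theI'[OF tensor_of_slices_ex1[OF assms], THEN spec])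

definition mprod ::
    "complex^'p^'n^'m \<Rightarrow> complex^'p^'p \<Rightarrow> complex^'p^'l^'n \<Rightarrow> complex^'p^'l^'m"
    ("(_ \<star>\<^bsub>_\<^esub> _)" [70, 0, 71] 70) where
  "A \<star>\<^bsub>M\<^esub> B = tensor_of_slices M (\<lambda>i. tslice M A i ** tslice M B i)"

definition tensor_id :: "complex^'p^'p \<Rightarrow> complex^'p^'m^'m" where
  "tensor_id M = tensor_of_slices M (\<lambda>i. mat 1)"

primrec tensor_pow :: "complex^'p^'p \<Rightarrow> complex^'p^'m^'m \<Rightarrow> nat \<Rightarrow> complex^'p^'m^'m" where
  "tensor_pow M A 0 = tensor_id M"
| "tensor_pow M A (Suc n) = A \<star>\<^bsub>M\<^esub> tensor_pow M A n"

definition conj_transpose :: "complex^'n^'m \<Rightarrow> complex^'m^'n" where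
  "conj_transpose A = (\<chi> i j. cnj (A $ j $ i))"

definition tensor_conj_transpose ::
    "complex^'p^'p \<Rightarrow> complex^'p^'n^'m \<Rightarrow> complex^'p^'m^'n" where
  "tensor_conj_transpose M A = tensor_of_slices M (\<lambda>i. conj_transpose (tslice M A i))"

definition tensor_range :: "complex^'p^'p \<Rightarrow> complex^'p^'n^'m \<Rightarrow> (complex^'p^1^'m) set" where
  "tensor_range M A = {A \<star>\<^bsub>M\<^esub> Z | Z :: complex^'p^1^'n. True}"

primrec matrix_pow :: "complex^'m^'m \<Rightarrow> nat \<Rightarrow> complex^'m^'m" where
  "matrix_pow A 0 = mat 1"
| "matrix_pow A (Suc n) = A ** matrix_pow A n"

definition matrix_index :: "complex^'m^'m \<Rightarrow> nat" where
  "matrix_index A = (LEAST k. rank (matrix_pow A k) = rank (matrix_pow A (k + 1)))"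

definition tubal_index :: "complex^'p^'p \<Rightarrow> complex^'p^'m^'m \<Rightarrow> nat" where
  "tubal_index M A = (MAX i. matrix_index (tslice M A i))"

definition drazin_inverse :: "complex^'p^'p \<Rightarrow> complex^'p^'m^'m \<Rightarrow> complex^'p^'m^'m" where
  "drazin_inverse M A = (THE X.
     X \<star>\<^bsub>M\<^esub> A \<star>\<^bsub>M\<^esub> X = X \<and>
     A \<star>\<^bsub>M\<^esub> X = X \<star>\<^bsub>M\<^esub> A \<and>
     X \<star>\<^bsub>M\<^esub> tensor_pow M A (tubal_index M A + 1) = tensor_pow M A (tubal_index M A))"

definition core_ep_inverse :: "complex^'p^'p \<Rightarrow> complex^'p^'m^'m \<Rightarrow> complex^'p^'m^'m" where
  "core_ep_inverse M A = (THE X.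
     X \<star>\<^bsub>M\<^esub> tensor_pow M A (tubal_index M A + 1) = tensor_pow M A (tubal_index M A) \<and>
     A \<star>\<^bsub>M\<^esub> tensor_pow M X 2 = X \<and>
     tensor_conj_transpose M (A \<star>\<^bsub>M\<^esub> X) = A \<star>\<^bsub>M\<^esub> X)"

end

theory Submission
  imports Defs
begin

text \<open>
  The transform turns the \<open>M\<close>-product, the powers, the identity and the conjugate transpose into the
  corresponding operations on frontal slices, and any family of matrices is the family of slices of
  exactly one tensor. Hence a tensor equation holds iff it holds on every slice, a tensor unknown may
  be chosen slice by slice (\<open>ex_tensor_iff_ex_slices\<close>), and the theorem reduces to a statement
  about one square matrix \<open>A\<close> with Drazin inverse \<open>D\<close> and core-EP inverse \<open>C\<close>, both taken
  with the exponent \<open>k\<close>, an upper bound for the index of \<open>A\<close>.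

  For a matrix (\<open>matrix_equation_solutions\<close>) there are two points. Firstly, \<open>AC\<close> is the
  orthogonal projector onto the range of \<open>A\<^sup>k\<close>, so it fixes every \<open>b\<close> in its range, and then
  \<open>A\<^sup>k\<^sup>+\<^sup>1(Cb) = A\<^sup>k(ACb) = A\<^sup>kb\<close>: the vector \<open>Cb\<close> is a particular solution. Secondly,
  \<open>A\<^sup>k\<^sup>+\<^sup>1DA = A\<^sup>k\<^sup>+\<^sup>1\<close> and \<open>DA = D\<^sup>k\<^sup>+\<^sup>1A\<^sup>k\<^sup>+\<^sup>1\<close>, so that
  \<open>A\<^sup>k\<^sup>+\<^sup>1y = 0\<close> iff \<open>DAy = 0\<close>; as \<open>DA\<close> is idempotent, the homogeneous solutions are the vectors
  \<open>(I - DA)z\<close>.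

  The inverses are given as definite descriptions, so most of the work is to show that each of them
  exists and is unique. Equality of the ranks of \<open>A\<^sup>k\<close> and \<open>A\<^sup>k\<^sup>+\<^sup>1\<close> gives factorizations
  \<open>A\<^sup>k = WA\<^sup>k\<^sup>+\<^sup>1 = A\<^sup>k\<^sup>+\<^sup>1Y\<close>, from which \<open>D\<close> is assembled algebraically
  (\<open>is_drazin_exists\<close>). With \<open>P\<close> the orthogonal projector onto the range of \<open>A\<^sup>k\<close>, the product
  \<open>DP\<close> is a core-EP inverse (\<open>is_core_ep_exists\<close>); conversely every core-EP inverse \<open>X\<close>
  satisfies \<open>AX = P\<close> and \<open>X = D(AX)\<close>, which determines it.
\<close>

section \<open>Matrix algebra\<close>

lemma matrix_mult_diff_left:
  fixes A :: "'a::ring_1^'n^'m" and B C :: "'a^'l^'n"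
  shows "A ** (B - C) = A ** B - A ** C"
  by (simp add: matrix_matrix_mult_def vec_eq_iff right_diff_distrib sum_subtractf)

lemma matrix_mult_diff_right:
  fixes A B :: "'a::ring_1^'n^'m" and C :: "'a^'l^'n"
  shows "(A - B) ** C = A ** C - B ** C"
  by (simp add: matrix_matrix_mult_def vec_eq_iff left_diff_distrib sum_subtractf)

lemma matrix_pow_add: "matrix_pow A (i + j) = matrix_pow A i ** matrix_pow A j"
  by (induction i) (simp_all add: matrix_mul_assoc)

lemma matrix_pow_commute: "matrix_pow A n ** A = A ** matrix_pow A n"
  by (induction n) (simp_all flip: matrix_mul_assoc)

lemma matrix_pow_Suc_right: "matrix_pow A (Suc n) = matrix_pow A n ** A"
  by (simp add: matrix_pow_commute)

lemma conj_transpose_mult: "conj_transpose (A ** B) = conj_transpose B ** conj_transpose A"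
  by (simp add: conj_transpose_def matrix_matrix_mult_def vec_eq_iff mult.commute)

lemma conj_transpose_conj_transpose [simp]: "conj_transpose (conj_transpose A) = A"
  by (simp add: conj_transpose_def vec_eq_iff)

text \<open>From \<open>B\<^sup>*Bx = 0\<close> it follows that \<open>\<parallel>Bx\<parallel>\<^sup>2 = x\<^sup>*B\<^sup>*Bx = 0\<close>.\<close>

lemma conj_transpose_mult_self_eq_0:
  fixes B :: "complex^'n^'m" and x :: "complex^'n"
  assumes "(conj_transpose B ** B) *v x = 0"
  shows "B *v x = 0"
proof -
  define y where "y = B *v x"
  have "conj_transpose B *v y = 0"
    using assms by (simp add: y_def matrix_vector_mul_assoc)
  then have *: "(\<Sum>i\<in>UNIV. cnj (B $ i $ j) * y $ i) = 0" for j
    by (simp add: vec_eq_iff conj_transpose_def matrix_vector_mult_def)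
  have "cnj (y $ i) = (\<Sum>j\<in>UNIV. cnj (x $ j) * cnj (B $ i $ j))" for i
    by (simp add: y_def matrix_vector_mult_def mult.commute)
  then have "(\<Sum>i\<in>UNIV. cnj (y $ i) * y $ i) =
      (\<Sum>i\<in>UNIV. \<Sum>j\<in>UNIV. cnj (x $ j) * (cnj (B $ i $ j) * y $ i))"
    by (simp add: sum_distrib_right mult.assoc)
  also have "\<dots> = (\<Sum>j\<in>UNIV. cnj (x $ j) * (\<Sum>i\<in>UNIV. cnj (B $ i $ j) * y $ i))"
    by (subst sum.swap) (simp add: sum_distrib_left)
  also have "\<dots> = 0"
    by (simp add: *)
  finally have "complex_of_real (\<Sum>i\<in>UNIV. (cmod (y $ i))\<^sup>2) = 0"
    by (simp add: complex_norm_square mult.commute del: of_real_power)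
  then have "(\<Sum>i\<in>UNIV. (cmod (y $ i))\<^sup>2) = 0"
    by (simp only: of_real_eq_0_iff)
  then have "y = 0"
    by (simp add: sum_nonneg_eq_0_iff vec_eq_iff)
  then show ?thesis
    by (simp add: y_def)
qed

section \<open>Factorization through ranges, kernels and ranks\<close>

text \<open>
  An inner inverse turns inclusions between ranges or kernels into explicit factorizations: if
  \<open>CGC = C\<close>, then \<open>CG\<close> fixes the range of \<open>C\<close>, and \<open>I - GC\<close> maps into its kernel.
\<close>

lemma matrix_inner_inverse:
  fixes C :: "'a::field^'n^'m"
  obtains G where "C ** G ** C = C"
proof -
  have "\<exists>g. g ` UNIV \<subseteq> UNIV \<and> Vector_Spaces.linear (*s) (*s) g \<and>
      (\<forall>v\<in>(*v) C ` UNIV. C *v (g v) = v)"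
    by (rule vec.linear_exists_right_inverse_on) (auto intro: vec.subspace_UNIV)
  then obtain g where g: "Vector_Spaces.linear (*s) (*s) g" "\<And>x. C *v (g (C *v x)) = C *v x"
    by auto
  have "(C ** matrix g ** C) *v x = C *v x" for x
    using g by (simp add: matrix_works flip: matrix_vector_mul_assoc)
  then show thesis
    by (intro that[of "matrix g"]) (simp add: matrix_eq)
qed

lemma range_subset_imp_right_factor:
  fixes P :: "'a::field^'n^'m" and Q :: "'a^'l^'m"
  assumes "range ((*v) P) \<subseteq> range ((*v) Q)"
  obtains Y where "P = Q ** Y"
proof -
  obtain G where G: "Q ** G ** Q = Q"
    by (rule matrix_inner_inverse)
  have "P *v x = (Q ** (G ** P)) *v x" for x
  proof -
    obtain z where z: "P *v x = Q *v z"
      using assms by blast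
    show ?thesis
      using z G by (metis matrix_vector_mul_assoc)
  qed
  then show thesis
    by (intro that[of "G ** P"]) (simp add: matrix_eq)
qed

lemma kernel_subset_imp_left_factor:
  fixes B :: "'a::field^'n^'m" and C :: "'a^'n^'l"
  assumes "\<And>x. C *v x = 0 \<Longrightarrow> B *v x = 0"
  obtains W where "B = W ** C"
proof -
  obtain G where G: "C ** G ** C = C"
    by (rule matrix_inner_inverse)
  have "B *v x = (B ** G ** C) *v x" for x
  proof -
    have "C *v (x - (G ** C) *v x) = 0"
      using G by (simp add: matrix_vector_mult_diff_distrib matrix_vector_mul_assoc matrix_mul_assoc)
    then have "B *v (x - (G ** C) *v x) = 0"
      by (rule assms)
    then show ?thesis
      by (simp add: matrix_vector_mult_diff_distrib matrix_vector_mul_assoc matrix_mul_assoc)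
  qed
  then show thesis
    by (intro that[of "B ** G"]) (simp add: matrix_eq)
qed

lemma subspace_range_matrix: "vec.subspace (range ((*v) (C :: 'a::field^'n^'m)))"
  by (intro vec.subspace_image vec.subspace_UNIV)

text \<open>
  The rank is defined through the span of the rows. Writing the row space as the range of the
  transpose makes the factorization lemmas for ranges applicable to it.
\<close>

lemma rank_eq_dim_row_space:
  fixes C :: "'a::field^'n^'m"
  shows "rank C = vec.dim (range ((*v) (transpose C)))"
proof -
  have "vec.span (rows C) = range ((*v) (transpose C))"
  proof
    have "row i C = transpose C *v axis i 1" for i
      by (simp add: row_def transpose_def matrix_vector_mult_def axis_def vec_eq_iff
          if_distrib cong: if_cong)
    then have "rows C \<subseteq> range ((*v) (transpose C))"
      by (auto simp: rows_def)
    then show "vec.span (rows C) \<subseteq> range ((*v) (transpose C))"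
      by (intro vec.span_minimal subspace_range_matrix)
  next
    have "transpose C *v x = (\<Sum>i\<in>UNIV. x $ i *s row i C)" for x
      by (simp add: row_def transpose_def matrix_vector_mult_def vec_eq_iff mult.commute)
    moreover have "(\<Sum>i\<in>UNIV. x $ i *s row i C) \<in> vec.span (rows C)" for x :: "'a^'m"
      by (intro vec.span_sum vec.span_scale vec.span_base) (auto simp: rows_def)
    ultimately show "range ((*v) (transpose C)) \<subseteq> vec.span (rows C)"
      by auto
  qed
  then show ?thesis
    by (metis row_rank_def_gen vec.dim_span)
qed

lemma row_space_mult_subset:
  fixes C :: "'a::field^'n^'m" and B :: "'a^'l^'n"
  shows "range ((*v) (transpose (C ** B))) \<subseteq> range ((*v) (transpose B))"
  by (auto simp: matrix_transpose_mul simp flip: matrix_vector_mul_assoc)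

lemma rank_mult_le_right:
  fixes C :: "'a::field^'n^'m" and B :: "'a^'l^'n"
  shows "rank (C ** B) \<le> rank B"
  unfolding rank_eq_dim_row_space by (intro vec.dim_subset row_space_mult_subset)

lemma rank_eq_imp_left_factor:
  fixes C :: "'a::field^'n^'m" and B :: "'a^'l^'n"
  assumes "rank (C ** B) = rank B"
  obtains W where "B = W ** (C ** B)"
proof -
  have "range ((*v) (transpose (C ** B))) = range ((*v) (transpose B))"
    using assms unfolding rank_eq_dim_row_space
    by (intro vec.subspace_dim_equal subspace_range_matrix row_space_mult_subset) simp
  then obtain Y where "transpose B = transpose (C ** B) ** Y"
    using range_subset_imp_right_factor[of "transpose B" "transpose (C ** B)"] by blast
  then have "B = transpose Y ** (C ** B)"
    by (metis matrix_transpose_mul transpose_transpose)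
  then show thesis
    by (rule that)
qed

text \<open>
  The first hypothesis makes \<open>A\<close> injective on the range of \<open>B\<close>, and the second makes this range
  invariant under \<open>A\<close>. By finite dimension \<open>A\<close> then maps the range onto itself. This yields the
  factorization on the right without comparing column rank and row rank.
\<close>

lemma left_factor_imp_right_factor:
  fixes A W :: "'a::field^'n^'n" and B :: "'a^'l^'n"
  assumes W: "B = W ** (A ** B)" and "range ((*v) (A ** B)) \<subseteq> range ((*v) B)"
  obtains Y where "B = A ** B ** Y"
proof -
  let ?V = "range ((*v) B)"
  have V: "vec.subspace ?V"
    by (rule subspace_range_matrix)
  have im: "(*v) A ` ?V = range ((*v) (A ** B))"
    by (auto simp: image_image simp flip: matrix_vector_mul_assoc)
  have "W *v (A *v v) = v" if "v \<in> ?V" for v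
    using that W by (metis (no_types, lifting) imageE matrix_vector_mul_assoc)
  then have "inj_on ((*v) A) ?V"
    by (metis inj_onI)
  then have "vec.dim ((*v) A ` ?V) = vec.dim ?V"
    using V by (intro vec.dim_image_eq) (simp_all add: vec.span_eq_iff[THEN iffD2])
  then have "(*v) A ` ?V = ?V"
    using assms(2) V unfolding im
    by (intro vec.subspace_dim_equal subspace_range_matrix) auto
  then show thesis
    using im that range_subset_imp_right_factor[of B "A ** B"] by blast
qed

section \<open>Powers beyond the index\<close>

text \<open>
  The set of exponents over which the index is the minimum is not empty: otherwise the ranks of the
  powers would decrease strictly for ever.
\<close>

lemma rank_matrix_pow_matrix_index:
  "rank (matrix_pow A (Suc (matrix_index A))) = rank (matrix_pow A (matrix_index A))"
proof -
  have "\<exists>k. rank (matrix_pow A k) = rank (matrix_pow A (k + 1))"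
  proof (rule ccontr)
    assume "\<not> ?thesis"
    then have less: "rank (matrix_pow A (Suc k)) < rank (matrix_pow A k)" for k
      using rank_mult_le_right[of A "matrix_pow A k"]
      by (metis Suc_eq_plus1 le_neq_implies_less matrix_pow.simps(2))
    have "rank (matrix_pow A k) + k \<le> rank (matrix_pow A 0)" for k
    proof (induction k)
      case (Suc k)
      then show ?case
        using less[of k] by linarith
    qed simp
    from this[of "Suc (rank (matrix_pow A 0))"] show False
      by simp
  qed
  then have "rank (matrix_pow A (matrix_index A)) = rank (matrix_pow A (matrix_index A + 1))"
    unfolding matrix_index_def by (rule LeastI_ex)
  then show ?thesis
    by simp
qed

text \<open>
  The factorization is stated for every exponent from the index onwards, because the tubal index is
  only an upper bound for the index of a single slice.
\<close>

lemma matrix_pow_left_factor: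
  assumes "matrix_index A \<le> k"
  obtains W where "matrix_pow A k = W ** matrix_pow A (Suc k)"
proof -
  let ?i = "matrix_index A"
  obtain W where W: "matrix_pow A ?i = W ** matrix_pow A (Suc ?i)"
    using rank_eq_imp_left_factor[of A "matrix_pow A ?i"] rank_matrix_pow_matrix_index[of A] by auto
  have "matrix_pow A k = matrix_pow A ?i ** matrix_pow A (k - ?i)"
    using assms by (simp flip: matrix_pow_add)
  also have "\<dots> = W ** (matrix_pow A (Suc ?i) ** matrix_pow A (k - ?i))"
    by (subst W) (simp only: matrix_mul_assoc)
  also have "\<dots> = W ** matrix_pow A (Suc k)"
    using assms by (simp flip: matrix_pow_add matrix_mul_assoc)
  finally show thesis
    by (rule that)
qed

lemma matrix_pow_right_factor:
  assumes "matrix_index A \<le> k"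
  obtains Y where "matrix_pow A k = matrix_pow A (Suc k) ** Y"
proof -
  obtain W where W: "matrix_pow A k = W ** matrix_pow A (Suc k)"
    using assms by (rule matrix_pow_left_factor)
  have "range ((*v) (A ** matrix_pow A k)) \<subseteq> range ((*v) (matrix_pow A k))"
    by (auto simp flip: matrix_pow_commute matrix_vector_mul_assoc)
  with W[unfolded matrix_pow.simps] obtain Y where "matrix_pow A k = A ** matrix_pow A k ** Y"
    by (rule left_factor_imp_right_factor)
  then have "matrix_pow A k = matrix_pow A (Suc k) ** Y"
    by (simp only: matrix_pow.simps)
  then show thesis
    by (rule that)
qed

lemma iterate_left_factor:
  assumes "matrix_pow A k = W ** matrix_pow A (Suc k)"
  shows "matrix_pow A k = matrix_pow W j ** matrix_pow A (k + j)"
proof (induction j)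
  case (Suc j)
  have "matrix_pow A k = matrix_pow W j ** (matrix_pow A k ** matrix_pow A j)"
    using Suc by (simp add: matrix_pow_add)
  also have "\<dots> = matrix_pow W j ** (W ** matrix_pow A (Suc k) ** matrix_pow A j)"
    using assms by simp
  also have "\<dots> = (matrix_pow W j ** W) ** (matrix_pow A (Suc k) ** matrix_pow A j)"
    by (simp only: matrix_mul_assoc)
  also have "\<dots> = matrix_pow W (Suc j) ** matrix_pow A (k + Suc j)"
    by (simp only: matrix_pow_Suc_right[of W] add_Suc_right flip: matrix_pow_add) simp
  finally show ?case .
qed simp

lemma iterate_right_factor:
  assumes "matrix_pow A k = matrix_pow A (Suc k) ** Y"
  shows "matrix_pow A k = matrix_pow A (k + j) ** matrix_pow Y j"
proof (induction j)
  case (Suc j)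
  have "matrix_pow A (k + j) = matrix_pow A j ** matrix_pow A k"
    by (simp only: matrix_pow_add add.commute[of k j])
  with Suc.IH have "matrix_pow A k = matrix_pow A j ** matrix_pow A k ** matrix_pow Y j"
    by metis
  also have "\<dots> = matrix_pow A j ** (matrix_pow A (Suc k) ** Y) ** matrix_pow Y j"
    by (simp only: flip: assms)
  also have "\<dots> = (matrix_pow A j ** matrix_pow A (Suc k)) ** (Y ** matrix_pow Y j)"
    by (simp only: matrix_mul_assoc)
  also have "\<dots> = matrix_pow A (k + Suc j) ** matrix_pow Y (Suc j)"
    by (simp only: add.commute[of k] add_Suc add_Suc_right flip: matrix_pow_add matrix_pow.simps(2))
  finally show ?case .
qed simp

text \<open>
  An equation \<open>X = AXX\<close> places the columns of \<open>X\<close> in the range of every power of \<open>A\<close>. Both the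
  Drazin and the core-EP inverse satisfy it.
\<close>

lemma eq_matrix_pow_mult:
  assumes AXX: "X = A ** X ** X"
  shows "X = matrix_pow A j ** matrix_pow X (Suc j)"
proof (induction j)
  case (Suc j)
  have "X = matrix_pow A j ** (X ** matrix_pow X j)"
    using Suc by simp
  also have "\<dots> = matrix_pow A j ** ((A ** X ** X) ** matrix_pow X j)"
    using AXX by simp
  also have "\<dots> = (matrix_pow A j ** A) ** (X ** (X ** matrix_pow X j))"
    by (simp only: matrix_mul_assoc)
  also have "\<dots> = matrix_pow A (Suc j) ** matrix_pow X (Suc (Suc j))"
    by (simp only: matrix_pow_Suc_right[of A] matrix_pow.simps(2)[of X])
  finally show ?case .
qed simp

section \<open>The Drazin inverse of a matrix\<close>

definition is_drazin :: "nat \<Rightarrow> complex^'m^'m \<Rightarrow> complex^'m^'m \<Rightarrow> bool" where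
  "is_drazin k A X \<longleftrightarrow>
     X ** A ** X = X \<and> A ** X = X ** A \<and> X ** matrix_pow A (k + 1) = matrix_pow A k"

text \<open>
  Put \<open>N = A\<^sup>2\<^sup>k\<^sup>+\<^sup>1\<close>. Iterating the two factorizations of \<open>A\<^sup>k\<close> gives \<open>A\<^sup>k = WN = NY\<close>. The
  matrix \<open>X = WNY\<close> then equals both \<open>WA\<^sup>k\<close> and \<open>A\<^sup>kY\<close>; each of the three equations follows by
  using the suitable form on each side.
\<close>

lemma is_drazin_exists:
  assumes "matrix_index A \<le> k"
  shows "\<exists>X. is_drazin k A X"
proof -
  obtain W\<^sub>1 where "matrix_pow A k = W\<^sub>1 ** matrix_pow A (Suc k)"
    using assms by (rule matrix_pow_left_factor)
  then obtain W where W: "matrix_pow A k = W ** matrix_pow A (k + Suc k)"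
    using iterate_left_factor by blast
  obtain Y\<^sub>1 where "matrix_pow A k = matrix_pow A (Suc k) ** Y\<^sub>1"
    using assms by (rule matrix_pow_right_factor)
  then obtain Y where Y: "matrix_pow A k = matrix_pow A (k + Suc k) ** Y"
    using iterate_right_factor by blast
  define N where "N = matrix_pow A (k + Suc k)"
  have W': "W ** N = matrix_pow A k" and Y': "N ** Y = matrix_pow A k"
    using W Y by (simp_all add: N_def)
  have N: "N = matrix_pow A k ** A ** matrix_pow A k"
    by (simp only: N_def matrix_pow_add matrix_pow.simps matrix_mul_assoc)
  have NA: "N ** A = A ** N"
    unfolding N_def by (rule matrix_pow_commute)
  define X where "X = W ** matrix_pow A k"
  have "X = W ** (N ** Y)"
    by (simp only: X_def Y')
  also have "\<dots> = matrix_pow A k ** Y"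
    by (simp only: W' matrix_mul_assoc)
  finally have X: "X = matrix_pow A k ** Y" .
  have "X ** A = W ** A ** matrix_pow A k"
    by (simp only: X_def matrix_pow_commute flip: matrix_mul_assoc)
  also have "\<dots> = W ** (A ** N) ** Y"
    by (simp only: Y' flip: matrix_mul_assoc)
  also have "\<dots> = W ** N ** A ** Y"
    by (simp only: NA[symmetric] matrix_mul_assoc)
  also have "\<dots> = A ** X"
    by (simp only: W' X matrix_pow_commute matrix_mul_assoc)
  finally have comm: "A ** X = X ** A" ..
  have "X ** A ** X = W ** matrix_pow A k ** A ** (matrix_pow A k ** Y)"
    by (simp only: flip: X X_def)
  also have "\<dots> = W ** (matrix_pow A k ** A ** matrix_pow A k) ** Y"
    by (simp only: matrix_mul_assoc)
  also have "\<dots> = X"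
    by (simp only: W' X flip: N)
  finally have "X ** A ** X = X" .
  moreover have "X ** matrix_pow A (k + 1) = W ** N"
    by (simp only: X_def N_def Suc_eq_plus1 matrix_pow_add matrix_mul_assoc)
  then have "X ** matrix_pow A (k + 1) = matrix_pow A k"
    by (simp only: W')
  ultimately show ?thesis
    using comm by (auto simp: is_drazin_def)
qed

lemma drazin_pow_left:
  assumes "is_drazin k A X"
  shows "X = matrix_pow X (Suc j) ** matrix_pow A j"
proof (induction j)
  case (Suc j)
  have XXA: "X = X ** X ** A"
    using assms by (metis is_drazin_def matrix_mul_assoc)
  have "X = matrix_pow X j ** X ** matrix_pow A j"
    using Suc by (simp only: matrix_pow_Suc_right)
  also have "\<dots> = matrix_pow X j ** (X ** X ** A) ** matrix_pow A j"
    using XXA by simp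
  also have "\<dots> = (matrix_pow X j ** X ** X) ** (A ** matrix_pow A j)"
    by (simp only: matrix_mul_assoc)
  also have "\<dots> = matrix_pow X (Suc (Suc j)) ** matrix_pow A (Suc j)"
    by (simp only: matrix_pow_Suc_right[of X] matrix_pow.simps(2)[of A])
  finally show ?case .
qed simp

lemma drazin_pow_right:
  assumes "is_drazin k A X"
  shows "X = matrix_pow A j ** matrix_pow X (Suc j)"
proof (rule eq_matrix_pow_mult)
  show "X = A ** X ** X"
    using assms by (metis is_drazin_def)
qed

lemma drazin_commute_pow:
  assumes "is_drazin k A X"
  shows "X ** matrix_pow A n = matrix_pow A n ** X"
proof (induction n)
  case (Suc n)
  then show ?case
    using assms by (metis is_drazin_def matrix_mul_assoc matrix_pow.simps(2))
qed simp

lemma drazin_cancel: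
  assumes "is_drazin k A X"
  shows "A ** X ** matrix_pow A k = matrix_pow A k"
proof -
  have "A ** X ** matrix_pow A k = X ** matrix_pow A (k + 1)"
    using assms by (simp add: is_drazin_def flip: matrix_mul_assoc)
  then show ?thesis
    using assms by (simp add: is_drazin_def)
qed

lemma drazin_cancel':
  assumes "is_drazin k A X"
  shows "matrix_pow A k ** X ** A = matrix_pow A k"
proof -
  have "matrix_pow A k ** X ** A = X ** (matrix_pow A k ** A)"
    by (simp only: drazin_commute_pow[OF assms, symmetric] matrix_mul_assoc)
  also have "\<dots> = X ** matrix_pow A (k + 1)"
    by (simp add: matrix_pow_commute)
  finally show ?thesis
    using assms by (simp add: is_drazin_def)
qed

text \<open>
  Write \<open>X\<close> with a right factor \<open>A\<^sup>k\<close> and \<open>X'\<close> with a left factor \<open>A\<^sup>k\<close>. The other inverse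
  cancels at that factor, so both equal \<open>XAX'\<close>.
\<close>

lemma is_drazin_unique:
  assumes X: "is_drazin k A X" and X': "is_drazin k A X'"
  shows "X = X'"
proof -
  have "X = matrix_pow X (Suc k) ** matrix_pow A k"
    using X by (rule drazin_pow_left)
  also have "\<dots> = matrix_pow X (Suc k) ** (matrix_pow A k ** X' ** A)"
    by (simp only: drazin_cancel'[OF X'])
  also have "\<dots> = (matrix_pow X (Suc k) ** matrix_pow A k) ** (X' ** A)"
    by (simp only: matrix_mul_assoc)
  also have "\<dots> = X ** (A ** X')"
    using X' by (simp only: is_drazin_def drazin_pow_left[OF X, symmetric])
  also have "\<dots> = A ** X ** X'"
    using X by (simp only: is_drazin_def matrix_mul_assoc)
  also have "\<dots> = A ** X ** (matrix_pow A k ** matrix_pow X' (Suc k))"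
    by (simp only: drazin_pow_right[OF X', symmetric])
  also have "\<dots> = A ** X ** matrix_pow A k ** matrix_pow X' (Suc k)"
    by (simp only: matrix_mul_assoc)
  also have "\<dots> = X'"
    by (simp only: drazin_cancel[OF X] drazin_pow_right[OF X', symmetric])
  finally show ?thesis .
qed

section \<open>The core-EP inverse of a matrix\<close>

definition is_core_ep :: "nat \<Rightarrow> complex^'m^'m \<Rightarrow> complex^'m^'m \<Rightarrow> bool" where
  "is_core_ep k A X \<longleftrightarrow>
     X ** matrix_pow A (k + 1) = matrix_pow A k \<and> A ** matrix_pow X 2 = X \<and>
     conj_transpose (A ** X) = A ** X"

text \<open>
  \<open>P\<close> is the orthogonal projector onto the range of \<open>B\<close>: idempotence is a consequence, since
  \<open>PP = PBV = BV = P\<close>.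
\<close>

definition is_orthogonal_projector :: "complex^'n^'m \<Rightarrow> complex^'m^'m \<Rightarrow> bool" where
  "is_orthogonal_projector B P \<longleftrightarrow>
     conj_transpose P = P \<and> P ** B = B \<and> (\<exists>V. P = B ** V)"

text \<open>
  Solve the normal equations \<open>B\<^sup>*BV = B\<^sup>*\<close> and put \<open>P = BV\<close>. They are solvable since \<open>B\<^sup>*B\<close>
  and \<open>B\<close> have the same kernel, which gives \<open>B = WB\<^sup>*B\<close>; take \<open>V = W\<^sup>*\<close>.
\<close>

lemma orthogonal_projector_exists: "\<exists>P. is_orthogonal_projector B P"
proof -
  obtain W where "B = W ** (conj_transpose B ** B)"
    using kernel_subset_imp_left_factor[of "conj_transpose B ** B" B] conj_transpose_mult_self_eq_0
    by blast
  then have normal: "conj_transpose B = conj_transpose B ** (B ** conj_transpose W)"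
    by (metis conj_transpose_conj_transpose conj_transpose_mult matrix_mul_assoc)
  define P where "P = B ** conj_transpose W"
  have BP: "conj_transpose B ** P = conj_transpose B"
    using normal by (simp add: P_def)
  have "conj_transpose P ** P = conj_transpose P"
    using BP unfolding P_def by (metis conj_transpose_mult matrix_mul_assoc)
  \<comment> \<open>\<open>P\<^sup>*P\<close> is Hermitian and equals \<open>P\<^sup>*\<close>.\<close>
  then have herm: "conj_transpose P = P"
    by (metis conj_transpose_conj_transpose conj_transpose_mult)
  then have "P ** B = B"
    using BP by (metis conj_transpose_conj_transpose conj_transpose_mult)
  then show ?thesis
    using herm by (auto simp: is_orthogonal_projector_def P_def)
qed

text \<open>Two such projectors satisfy \<open>PP' = P'\<close> and \<open>P'P = P\<close>; adjoints identify the two products.\<close>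

lemma orthogonal_projector_unique:
  assumes "is_orthogonal_projector B P" and "is_orthogonal_projector B P'"
  shows "P = P'"
proof -
  have "P ** P' = P'" and "P' ** P = P"
    using assms by (auto simp: is_orthogonal_projector_def matrix_mul_assoc)
  then show ?thesis
    using assms by (metis conj_transpose_mult is_orthogonal_projector_def)
qed

text \<open>
  The witness is \<open>DP\<close> with \<open>P\<close> the orthogonal projector onto the range of \<open>A\<^sup>k\<close>. On this range
  \<open>AD\<close> is the identity, so \<open>ADP = P\<close>; and the range contains that of \<open>D\<close>, so \<open>PD = D\<close>.
\<close>

lemma is_core_ep_exists:
  assumes "is_drazin k A D"
  shows "\<exists>X. is_core_ep k A X"
proof -
  obtain P where "is_orthogonal_projector (matrix_pow A k) P"
    using orthogonal_projector_exists by blast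
  then obtain V where herm: "conj_transpose P = P" and PA: "P ** matrix_pow A k = matrix_pow A k"
    and V: "P = matrix_pow A k ** V"
    by (auto simp: is_orthogonal_projector_def)
  have ADP: "A ** D ** P = P"
    using drazin_cancel[OF assms] V by (metis matrix_mul_assoc)
  have PD: "P ** D = D"
    using drazin_pow_right[OF assms, of k] PA by (metis matrix_mul_assoc)
  have "D ** P ** matrix_pow A (k + 1) = D ** (P ** matrix_pow A k) ** A"
    by (simp only: Suc_eq_plus1[symmetric] matrix_pow_Suc_right matrix_mul_assoc)
  also have "\<dots> = D ** matrix_pow A (k + 1)"
    by (simp only: PA Suc_eq_plus1[symmetric] matrix_pow_Suc_right matrix_mul_assoc)
  finally have "D ** P ** matrix_pow A (k + 1) = matrix_pow A k"
    using assms by (simp add: is_drazin_def)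
  moreover have "A ** matrix_pow (D ** P) 2 = A ** D ** P ** D ** P"
    by (simp add: numeral_2_eq_2 matrix_mul_assoc)
  then have "A ** matrix_pow (D ** P) 2 = D ** P"
    by (simp add: ADP PD)
  moreover have "conj_transpose (A ** (D ** P)) = A ** (D ** P)"
    using ADP herm by (simp add: matrix_mul_assoc)
  ultimately show ?thesis
    by (auto simp: is_core_ep_def)
qed

lemma core_ep_pow_right:
  assumes "is_core_ep k A X"
  shows "X = matrix_pow A j ** matrix_pow X (Suc j)"
proof (rule eq_matrix_pow_mult)
  show "X = A ** X ** X"
    using assms by (simp add: is_core_ep_def numeral_2_eq_2 matrix_mul_assoc)
qed

text \<open>
  The defining equation \<open>XA\<^sup>k\<^sup>+\<^sup>1 = A\<^sup>k\<close> says nothing directly about \<open>AXA\<^sup>k\<close>; the Drazin inverse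
  supplies the missing power of \<open>A\<close> through \<open>A\<^sup>k = A\<^sup>k\<^sup>+\<^sup>1D\<close>.
\<close>

lemma core_ep_projector:
  assumes D: "is_drazin k A D" and X: "is_core_ep k A X"
  shows "is_orthogonal_projector (matrix_pow A k) (A ** X)"
proof -
  have XA: "X ** matrix_pow A (k + 1) = matrix_pow A k"
    using X by (simp add: is_core_ep_def)
  have AD: "matrix_pow A k = matrix_pow A (k + 1) ** D"
    using D by (simp only: is_drazin_def drazin_commute_pow[OF D, symmetric])
  have "A ** X ** matrix_pow A k = A ** (X ** matrix_pow A (k + 1)) ** D"
    by (subst AD) (simp only: matrix_mul_assoc)
  also have "\<dots> = A ** matrix_pow A k ** D"
    by (simp only: XA)
  also have "\<dots> = matrix_pow A k"
    using AD by simp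
  finally have "A ** X ** matrix_pow A k = matrix_pow A k" .
  moreover have "A ** X = A ** (matrix_pow A k ** matrix_pow X (Suc k))"
    using core_ep_pow_right[OF X, of k] by simp
  then have "A ** X = matrix_pow A k ** (A ** matrix_pow X (Suc k))"
    by (metis matrix_mul_assoc matrix_pow_commute)
  ultimately show ?thesis
    using X by (auto simp: is_orthogonal_projector_def is_core_ep_def)
qed

text \<open>The columns of \<open>X\<close> lie in the range of \<open>A\<^sup>k\<close>, where \<open>DA\<close> is the identity.\<close>

lemma core_ep_eq_drazin_mult:
  assumes D: "is_drazin k A D" and X: "is_core_ep k A X"
  shows "X = D ** (A ** X)"
proof -
  have "A ** D ** X = (A ** D ** matrix_pow A k) ** matrix_pow X (Suc k)"
    using core_ep_pow_right[OF X, of k] by (metis matrix_mul_assoc)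
  also have "\<dots> = X"
    using core_ep_pow_right[OF X, of k] drazin_cancel[OF D] by simp
  finally show ?thesis
    using D by (metis is_drazin_def matrix_mul_assoc)
qed

lemma is_core_ep_unique:
  assumes "is_drazin k A D" and "is_core_ep k A X" and "is_core_ep k A X'"
  shows "X = X'"
  using assms by (metis core_ep_eq_drazin_mult core_ep_projector orthogonal_projector_unique)

section \<open>The matrix equation\<close>

text \<open>
  The hypothesis on \<open>b\<close> gives \<open>ACb = b\<close>, which makes \<open>Cb\<close> a particular solution. The matrices
  \<open>(I - DA)z\<close> are the solutions of the homogeneous equation.
\<close>

lemma matrix_equation_solutions:
  fixes A D C :: "complex^'m^'m" and b b' x :: "complex^'l^'m"
  assumes D: "is_drazin k A D" and C: "is_core_ep k A C" and b: "b = A ** C ** b'"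
  shows "matrix_pow A (k + 1) ** x = matrix_pow A k ** b \<longleftrightarrow>
    (\<exists>z. x = C ** b + (mat 1 - D ** A) ** z)"
proof -
  let ?E = "mat 1 - D ** A"
  obtain V where PA: "A ** C ** matrix_pow A k = matrix_pow A k"
    and V: "A ** C = matrix_pow A k ** V"
    using core_ep_projector[OF D C] by (auto simp: is_orthogonal_projector_def)
  have "A ** C ** b = b"
    using PA V b by (metis matrix_mul_assoc)
  then have part: "matrix_pow A (k + 1) ** (C ** b) = matrix_pow A k ** b"
    by (metis Suc_eq_plus1 matrix_mul_assoc matrix_pow_Suc_right)
  have ker: "matrix_pow A (k + 1) ** y = 0 \<longleftrightarrow> (\<exists>z. y = ?E ** z)" for y :: "complex^'l^'m"
  proof
    assume y: "matrix_pow A (k + 1) ** y = 0"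
    have "D ** A = matrix_pow D (Suc k) ** matrix_pow A (k + 1)"
      using drazin_pow_left[OF D, of k] by (metis Suc_eq_plus1 matrix_mul_assoc matrix_pow_Suc_right)
    then have "D ** A ** y = 0"
      using y by (metis matrix_mul_assoc times0_right)
    \<comment> \<open>Hence \<open>I - DA\<close> fixes \<open>y\<close>, and \<open>y\<close> itself is the witness.\<close>
    then show "\<exists>z. y = ?E ** z"
      by (intro exI[of _ y]) (simp add: matrix_mult_diff_right)
  next
    assume "\<exists>z. y = ?E ** z"
    moreover have "matrix_pow A (k + 1) ** (D ** A) = matrix_pow A (k + 1)"
      using drazin_cancel'[OF D] by (simp flip: matrix_mul_assoc)
    then have "matrix_pow A (k + 1) ** ?E = 0"
      by (simp add: matrix_mult_diff_left)
    ultimately show "matrix_pow A (k + 1) ** y = 0"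
      by (metis matrix_mul_assoc times0_left)
  qed
  have "matrix_pow A (k + 1) ** x = matrix_pow A k ** b \<longleftrightarrow> matrix_pow A (k + 1) ** (x - C ** b) = 0"
    by (simp only: matrix_mult_diff_left part right_minus_eq)
  also have "\<dots> \<longleftrightarrow> (\<exists>z. x - C ** b = ?E ** z)"
    by (rule ker)
  also have "\<dots> \<longleftrightarrow> (\<exists>z. x = C ** b + ?E ** z)"
    by (simp add: diff_eq_eq add.commute)
  finally show ?thesis .
qed

section \<open>Tensors slice by slice\<close>

lemma tensor_eq_iff:
  assumes "invertible M"
  shows "A = B \<longleftrightarrow> (\<forall>i. tslice M A i = tslice M B i)"
  using tensor_of_slices_ex1[OF assms, of "tslice M B"] by auto

lemma tslice_mprod: "invertible M \<Longrightarrow> tslice M (A \<star>\<^bsub>M\<^esub> B) i = tslice M A i ** tslice M B i"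
  by (simp add: mprod_def tslice_tensor_of_slices)

lemma tslice_tensor_id: "invertible M \<Longrightarrow> tslice M (tensor_id M) i = mat 1"
  by (simp add: tensor_id_def tslice_tensor_of_slices)

lemma tslice_tensor_pow:
  "invertible M \<Longrightarrow> tslice M (tensor_pow M A n) i = matrix_pow (tslice M A i) n"
  by (induction n) (simp_all add: tslice_tensor_id tslice_mprod)

lemma tslice_tensor_conj_transpose:
  "invertible M \<Longrightarrow> tslice M (tensor_conj_transpose M A) i = conj_transpose (tslice M A i)"
  by (simp add: tensor_conj_transpose_def tslice_tensor_of_slices)

lemma tslice_add: "tslice M (A + B) i = tslice M A i + tslice M B i"
  by (simp add: frontal_slice_def mtransform_def vec_eq_iff distrib_right sum.distrib)

lemma tslice_diff: "tslice M (A - B) i = tslice M A i - tslice M B i"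
  by (simp add: frontal_slice_def mtransform_def vec_eq_iff left_diff_distrib sum_subtractf)

lemma ex_tensor_iff_ex_slices:
  assumes "invertible M"
  shows "(\<exists>Z. \<forall>i. P i (tslice M Z i)) \<longleftrightarrow> (\<forall>i. \<exists>z. P i z)"
proof
  assume "\<forall>i. \<exists>z. P i z"
  then obtain z where "\<forall>i. P i (z i)"
    by metis
  then show "\<exists>Z. \<forall>i. P i (tslice M Z i)"
    by (intro exI[of _ "tensor_of_slices M z"]) (simp add: tslice_tensor_of_slices[OF assms])
qed blast

lemma ex1_tensor_of_ex1_slices:
  assumes "invertible M" and "\<And>i. \<exists>!z. P i z"
  shows "\<exists>!Z. \<forall>i. P i (tslice M Z i)"
proof (rule ex_ex1I)
  show "\<exists>Z. \<forall>i. P i (tslice M Z i)"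
    unfolding ex_tensor_iff_ex_slices[OF assms(1)] using assms(2) by blast
next
  fix Y Z
  assume "\<forall>i. P i (tslice M Y i)" and "\<forall>i. P i (tslice M Z i)"
  then show "Y = Z"
    unfolding tensor_eq_iff[OF assms(1)] using assms(2) by blast
qed

lemma matrix_index_le_tubal_index: "matrix_index (tslice M A i) \<le> tubal_index M A"
  unfolding tubal_index_def by (intro Max_ge) auto

text \<open>
  The defining equations of either inverse decouple into equations on the slices, all with the tubal
  index as exponent. Existence and uniqueness on each slice make the definite description proper.
\<close>

lemma tslice_drazin_inverse:
  assumes M: "invertible M"
  shows "is_drazin (tubal_index M A) (tslice M A i) (tslice M (drazin_inverse M A) i)"
proof -
  have ex1: "\<exists>!Z. \<forall>i. is_drazin (tubal_index M A) (tslice M A i) (tslice M Z i)"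
    by (rule ex1_tensor_of_ex1_slices[OF M])
      (meson is_drazin_exists is_drazin_unique matrix_index_le_tubal_index)
  have "drazin_inverse M A =
      (THE Z. \<forall>i. is_drazin (tubal_index M A) (tslice M A i) (tslice M Z i))"
    unfolding drazin_inverse_def
    by (rule arg_cong[where f = The])
      (auto simp: fun_eq_iff is_drazin_def tensor_eq_iff[OF M] tslice_mprod[OF M]
        tslice_tensor_pow[OF M])
  then show ?thesis
    using theI'[OF ex1] by simp
qed

lemma tslice_core_ep_inverse:
  assumes M: "invertible M"
  shows "is_core_ep (tubal_index M A) (tslice M A i) (tslice M (core_ep_inverse M A) i)"
proof -
  have ex1: "\<exists>!Z. \<forall>i. is_core_ep (tubal_index M A) (tslice M A i) (tslice M Z i)"
    by (rule ex1_tensor_of_ex1_slices[OF M])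
      (meson is_drazin_exists is_core_ep_exists is_core_ep_unique matrix_index_le_tubal_index)
  have "core_ep_inverse M A =
      (THE Z. \<forall>i. is_core_ep (tubal_index M A) (tslice M A i) (tslice M Z i))"
    unfolding core_ep_inverse_def
    by (rule arg_cong[where f = The])
      (auto simp: fun_eq_iff is_core_ep_def tensor_eq_iff[OF M] tslice_mprod[OF M]
        tslice_tensor_pow[OF M] tslice_tensor_conj_transpose[OF M])
  then show ?thesis
    using theI'[OF ex1] by simp
qed

theorem theorem6p4:
  fixes M :: "complex^'p^'p" and A :: "complex^'p^'m^'m" and B :: "complex^'p^1^'m" and k :: nat
  assumes "invertible M"
    and "tubal_index M A = k"
    and "B \<in> tensor_range M (A \<star>\<^bsub>M\<^esub> core_ep_inverse M A)"
  shows "{X :: complex^'p^1^'m. tensor_pow M A (k + 1) \<star>\<^bsub>M\<^esub> X = tensor_pow M A k \<star>\<^bsub>M\<^esub> B} =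
    {core_ep_inverse M A \<star>\<^bsub>M\<^esub> B + (tensor_id M - drazin_inverse M A \<star>\<^bsub>M\<^esub> A) \<star>\<^bsub>M\<^esub> Z
      | Z :: complex^'p^1^'m. True}"
proof -
  note M = assms(1)
  let ?a = "tslice M A" and ?b = "tslice M B"
  let ?c = "tslice M (core_ep_inverse M A)" and ?d = "tslice M (drazin_inverse M A)"
  obtain B' :: "complex^'p^1^'m" where B': "B = A \<star>\<^bsub>M\<^esub> core_ep_inverse M A \<star>\<^bsub>M\<^esub> B'"
    using assms(3) by (auto simp: tensor_range_def)
  have slices: "matrix_pow (?a i) (k + 1) ** x = matrix_pow (?a i) k ** ?b i \<longleftrightarrow>
      (\<exists>z. x = ?c i ** ?b i + (mat 1 - ?d i ** ?a i) ** z)" for i x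
  proof (rule matrix_equation_solutions)
    show "is_drazin k (?a i) (?d i)" "is_core_ep k (?a i) (?c i)"
      using tslice_drazin_inverse[OF M] tslice_core_ep_inverse[OF M] assms(2) by auto
    show "?b i = ?a i ** ?c i ** tslice M B' i"
      by (subst B') (simp add: tslice_mprod[OF M])
  qed
  have "tensor_pow M A (k + 1) \<star>\<^bsub>M\<^esub> X = tensor_pow M A k \<star>\<^bsub>M\<^esub> B \<longleftrightarrow>
      (\<exists>Z :: complex^'p^1^'m. X = core_ep_inverse M A \<star>\<^bsub>M\<^esub> B +
        (tensor_id M - drazin_inverse M A \<star>\<^bsub>M\<^esub> A) \<star>\<^bsub>M\<^esub> Z)" for X :: "complex^'p^1^'m"
  proof -
    have "tensor_pow M A (k + 1) \<star>\<^bsub>M\<^esub> X = tensor_pow M A k \<star>\<^bsub>M\<^esub> B \<longleftrightarrow>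
        (\<forall>i. matrix_pow (?a i) (k + 1) ** tslice M X i = matrix_pow (?a i) k ** ?b i)"
      by (simp only: tensor_eq_iff[OF M] tslice_mprod[OF M] tslice_tensor_pow[OF M])
    also have "\<dots> \<longleftrightarrow> (\<forall>i. \<exists>z. tslice M X i = ?c i ** ?b i + (mat 1 - ?d i ** ?a i) ** z)"
      by (simp only: slices)
    also have "\<dots> \<longleftrightarrow> (\<exists>Z :: complex^'p^1^'m. \<forall>i.
        tslice M X i = ?c i ** ?b i + (mat 1 - ?d i ** ?a i) ** tslice M Z i)"
      by (rule ex_tensor_iff_ex_slices[OF M, symmetric])
    also have "\<dots> \<longleftrightarrow> (\<exists>Z :: complex^'p^1^'m. X = core_ep_inverse M A \<star>\<^bsub>M\<^esub> B +
        (tensor_id M - drazin_inverse M A \<star>\<^bsub>M\<^esub> A) \<star>\<^bsub>M\<^esub> Z)"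
      by (simp only: tensor_eq_iff[OF M] tslice_mprod[OF M] tslice_add tslice_diff
          tslice_tensor_id[OF M])
    finally show ?thesis .
  qed
  then show ?thesis
    by blast
qed

end
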